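(* Let $m\ge 1$ and let $\nu_1,\ldots,\nu_m,l_1,\ldots,l_m$ be positive integers with $1\le \nu_j\le l_j$ for $j=1,\ldots,m$; put $M:=\nu_1+\ldots+\nu_m$ and $L:=l_1+\ldots+l_m$ (so $M\le L$). Let $\alpha_1,\ldots,\alpha_m$ be distinct variables and $\overline{\alpha}=(\alpha_1,\ldots,\alpha_m)^T$. Let $\mathcal{V}(\overline{\alpha})$ be the $M\times(L+1)$ matrix over $\mathbb{Z}[\alpha_1,\ldots,\alpha_m]$ whose rows are indexed by the pairs $(j,i)$ with $j=1,\ldots,m$ and $i=1,\ldots,\nu_j$ (ordered lexicographically), whose columns are indexed by $h=0,1,\ldots,L$, and whose entry in row $(j,i)$ and column $h$ is $\binom{L+i}{h}\alpha_j^{L-h}$. Let $\widehat{D}(\overline{\alpha})\in\mathbb{Z}[\alpha_1,\ldots,\alpha_m]$ be the (primitive) greatest common divisor of the $M\times M$ minors of $\mathcal{V}(\overline{\alpha})$. Then, in $\mathbb{Z}[\alpha_1,\ldots,\alpha_m]$, $$ \left(\prod_{1\le j\le m}\alpha_j^{\binom{\nu_j}{2}}\right)\prod_{1\le i<j\le m}(\alpha_i-\alpha_j)^{\min\{\nu_i^2,\,\nu_j^2\}}\ \Big|\ \widehat{D}(\overline{\alpha}). $$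
   Context: A polynomial in $\mathbb{Z}[\alpha_1,\ldots,\alpha_m]$ is primitive if the gcd of its coefficients is $1$. The polynomial $\widehat{D}(\overline{\alpha})$ is taken to be primitive: it is the greatest common divisor of the minors in the UFD $\mathbb{Z}[\alpha_1,\ldots,\alpha_m]$ with its integer content divided out. *)

theory Defs
  imports "HOL-Library.Poly_Mapping" "Jordan_Normal_Form.Determinant"
    "Jordan_Normal_Form.DL_Submatrix"
begin

text \<open>The ring of integer polynomials in the variables indexed by \<open>'m\<close>: finitely supported
  maps from exponent vectors to coefficients, with convolution as multiplication. The theorem
  uses a finite linearly ordered \<open>'m\<close>, the abstract form of the index set \<open>{1..m}\<close>;
  \<open>m\<close> is \<open>CARD('m)\<close>, and \<open>m \<ge> 1\<close> because types are inhabited.\<close>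

type_synonym 'm int_mpoly = "('m \<Rightarrow>\<^sub>0 nat) \<Rightarrow>\<^sub>0 int"

definition Var :: "'m \<Rightarrow> 'm int_mpoly" where
  "Var j = Poly_Mapping.single (Poly_Mapping.single j 1) 1"

definition content :: "'m int_mpoly \<Rightarrow> int" where
  "content p = Gcd (Poly_Mapping.lookup p ` Poly_Mapping.keys p)"

definition primitive :: "'m int_mpoly \<Rightarrow> bool" where
  "primitive p \<longleftrightarrow> content p = 1"

definition is_gcd_of :: "'a::comm_monoid_mult \<Rightarrow> 'a set \<Rightarrow> bool" where
  "is_gcd_of G S \<longleftrightarrow> (\<forall>s\<in>S. G dvd s) \<and> (\<forall>c. (\<forall>s\<in>S. c dvd s) \<longrightarrow> c dvd G)"

text \<open>\<open>D\<close> is a greatest common divisor \<open>G\<close> of \<open>S\<close> with its integer content divided out.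
  A gcd is only determined up to a unit, so this is a predicate, which determines \<open>D\<close> up to sign
  as soon as \<open>S\<close> contains a nonzero element.\<close>

definition is_primitive_gcd_of :: "'m int_mpoly \<Rightarrow> 'm int_mpoly set \<Rightarrow> bool" where
  "is_primitive_gcd_of D S \<longleftrightarrow>
     primitive D \<and> (\<exists>G. is_gcd_of G S \<and> G = of_int (content G) * D)"

text \<open>The pairs \<open>(j, i)\<close> with \<open>1 \<le> i \<le> \<nu> j\<close> in lexicographic order.\<close>

definition row_index :: "('m::{finite,linorder} \<Rightarrow> nat) \<Rightarrow> ('m \<times> nat) list" where
  "row_index \<nu> = concat (map (\<lambda>j. map (\<lambda>i. (j, i)) [1..<Suc (\<nu> j)]) (sorted_list_of_set UNIV))"

definition V_mat ::
    "('m::{finite,linorder} \<Rightarrow> nat) \<Rightarrow> ('m \<Rightarrow> nat) \<Rightarrow> 'm int_mpoly mat" where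
  "V_mat \<nu> l = (let M = (\<Sum>j\<in>UNIV. \<nu> j); L = (\<Sum>j\<in>UNIV. l j) in
     mat M (L + 1) (\<lambda>(r, h). let (j, i) = row_index \<nu> ! r in
       of_nat ((L + i) choose h) * Var j ^ (L - h)))"

definition minors :: "nat \<Rightarrow> 'a::comm_ring_1 mat \<Rightarrow> 'a set" where
  "minors k A = {det (submatrix A I J) | I J.
     I \<subseteq> {..<dim_row A} \<and> J \<subseteq> {..<dim_col A} \<and> card I = k \<and> card J = k}"

end

theory Submission
  imports Defs "HOL-Computational_Algebra.Polynomial"
begin

text \<open>
  The elements \<open>\<alpha>\<^sub>j\<close> and \<open>\<alpha>\<^sub>i - \<alpha>\<^sub>j\<close> are pairwise non-associated primes that divide no nonzero
  integer, so once the gcd is known to be nonzero it suffices that each minor is divisible by each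
  of the prime powers. For \<open>\<alpha>\<^sub>j\<close>, every term of the Leibniz expansion contains the powers of
  \<open>\<alpha>\<^sub>j\<close> with \<open>\<nu>\<^sub>j\<close> distinct exponents. For \<open>\<alpha>\<^sub>i - \<alpha>\<^sub>j\<close>, put \<open>k = min \<nu>\<^sub>i \<nu>\<^sub>j\<close>; up to
  factors prime to \<open>\<alpha>\<^sub>i - \<alpha>\<^sub>j\<close>, the first \<open>k\<close> rows of each of the two blocks are the Hasse
  derivatives of order below \<open>k\<close> of one vector of polynomials at \<open>\<alpha>\<^sub>i\<close> and at \<open>\<alpha>\<^sub>j\<close>, and
  Taylor expansion at \<open>\<alpha>\<^sub>j\<close> yields the exponent \<open>k\<^sup>2\<close>. The gcd is nonzero because the minor
  of the first \<open>M\<close> columns has a monomial whose coefficient is a block diagonal determinant of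
  binomial coefficients.
\<close>

subsection \<open>Prime elements in the polynomial ring\<close>

text \<open>Induction on \<open>n\<close>: primality puts one factor \<open>p\<close> into
  \<open>b\<close>, and cancelling it lowers the exponent.\<close>

lemma prime_elem_power_dvd_multD:
  fixes p :: "'a::idom"
  assumes "prime_elem p" "\<not> p dvd a" "p ^ n dvd a * b"
  shows "p ^ n dvd b"
  using assms(3)
proof (induction n arbitrary: b)
  case (Suc n)
  have "p dvd a * b"
    using Suc.prems dvd_mult_left by fastforce
  then obtain c where c: "b = p * c"
    using assms(1,2) by (auto simp: prime_elem_dvd_mult_iff)
  then have "p * p ^ n dvd p * (a * c)"
    using Suc.prems by (simp add: mult_ac)
  then have "p ^ n dvd a * c"
    using prime_elem_not_zeroI[OF assms(1)] by (simp only: dvd_mult_cancel_left) simp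
  from Suc.IH[OF this] show ?case
    by (simp add: c)
qed simp

lemma prime_elem_dvd_prodD:
  assumes "prime_elem p" "p dvd prod f A"
  shows "\<exists>x\<in>A. p dvd f x"
  using assms(2)
proof (induction A rule: infinite_finite_induct)
  case (insert x A)
  then show ?case
    using prime_elem_dvd_multD[OF assms(1), of "f x" "prod f A"] by auto
qed (use prime_elem_not_unit[OF assms(1)] in auto)

text \<open>Mutual non-divisibility plays the part of coprimality: \<open>q s\<close> does not
  divide the product already split off, so its power passes to the cofactor.\<close>

lemma prod_prime_powers_dvd:
  fixes q :: "'i \<Rightarrow> 'a::idom"
  assumes "finite S" "\<And>s. s \<in> S \<Longrightarrow> prime_elem (q s)"
    and "\<And>s t. s \<in> S \<Longrightarrow> t \<in> S \<Longrightarrow> s \<noteq> t \<Longrightarrow> \<not> q s dvd q t"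
    and "\<And>s. s \<in> S \<Longrightarrow> q s ^ e s dvd D"
  shows "(\<Prod>s\<in>S. q s ^ e s) dvd D"
  using assms
proof (induction S rule: finite_induct)
  case (insert s S)
  then obtain E where E: "D = (\<Prod>s\<in>S. q s ^ e s) * E"
    by (metis dvdE insertCI)
  have "\<not> q s dvd (\<Prod>s\<in>S. q s ^ e s)"
  proof
    assume "q s dvd (\<Prod>s\<in>S. q s ^ e s)"
    then obtain t where t: "t \<in> S" "q s dvd q t ^ e t"
      using prime_elem_dvd_prodD insert.prems(1) by blast
    then have "q s dvd q t"
      using prime_elem_dvd_power insert.prems(1) by blast
    with t show False
      using insert by (metis insertCI)
  qed
  moreover have "q s ^ e s dvd (\<Prod>s\<in>S. q s ^ e s) * E"
    using insert.prems(3)[of s] by (simp add: E)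
  ultimately have "q s ^ e s dvd E"
    using prime_elem_power_dvd_multD insert.prems(1) by blast
  then show ?case
    using insert.hyps by (simp add: E mult.commute mult_dvd_mono)
qed simp

section \<open>Evaluation homomorphisms on integer polynomials\<close>

definition insertion :: "('m::finite \<Rightarrow> 'a::comm_ring_1) \<Rightarrow> 'm int_mpoly \<Rightarrow> 'a" where
  "insertion f p = (\<Sum>m\<in>Poly_Mapping.keys p. of_int (Poly_Mapping.lookup p m) *
     (\<Prod>v\<in>UNIV. f v ^ Poly_Mapping.lookup m v))"

lemma insertion_superset:
  assumes "finite S" "Poly_Mapping.keys p \<subseteq> S"
  shows "insertion f p = (\<Sum>m\<in>S. of_int (Poly_Mapping.lookup p m) *
     (\<Prod>v\<in>UNIV. f v ^ Poly_Mapping.lookup m v))"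
  unfolding insertion_def
  by (rule sum.mono_neutral_left) (use assms in \<open>auto simp: in_keys_iff\<close>)

lemma insertion_add: "insertion f (p + q) = insertion f p + insertion f q"
proof -
  let ?S = "Poly_Mapping.keys p \<union> Poly_Mapping.keys q"
  show ?thesis
    using insertion_superset[of ?S "p + q" f] insertion_superset[of ?S p f]
      insertion_superset[of ?S q f] Poly_Mapping.keys_add[of p q]
    by (simp add: lookup_add distrib_right sum.distrib)
qed

lemma insertion_single:
  "insertion f (Poly_Mapping.single m c) = of_int c * (\<Prod>v\<in>UNIV. f v ^ Poly_Mapping.lookup m v)"
  by (subst insertion_superset[of "{m}"]) auto

lemma int_mpoly_induct [case_names single add]:
  fixes p :: "'m int_mpoly"
  assumes "\<And>m c. P (Poly_Mapping.single m c)" "\<And>p q. P p \<Longrightarrow> P q \<Longrightarrow> P (p + q)"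
  shows "P p"
proof -
  have "P (\<Sum>m\<in>S. Poly_Mapping.single m (Poly_Mapping.lookup p m))" for S
  proof (induction S rule: infinite_finite_induct)
    case (insert x F)
    then show ?case
      using assms by simp
  qed (use assms(1)[of 0 0] in auto)
  moreover have "(\<Sum>m\<in>Poly_Mapping.keys p. Poly_Mapping.single m (Poly_Mapping.lookup p m)) = p"
    by (rule poly_mapping_eqI)
      (auto simp: lookup_sum lookup_single when_def in_keys_iff)
  ultimately show ?thesis
    by metis
qed

lemma insertion_mult: "insertion f (p * q) = insertion f p * insertion f q"
proof (induction p rule: int_mpoly_induct)
  case (single m c)
  show ?case
    by (induction q rule: int_mpoly_induct)
      (simp_all add: mult_single insertion_single lookup_add power_add prod.distrib
        insertion_add distrib_left distrib_right mult_ac)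
qed (simp add: insertion_add distrib_right)

lemma insertion_of_int [simp]: "insertion f (of_int c) = of_int c"
  by (simp add: insertion_single flip: single_of_int)

lemma insertion_1 [simp]: "insertion f 1 = 1"
  using insertion_of_int[of f 1] by simp

lemma insertion_0 [simp]: "insertion f 0 = 0"
  using insertion_of_int[of f 0] by simp

lemma insertion_of_nat [simp]: "insertion f (of_nat n) = of_nat n"
  using insertion_of_int[of f "int n"] by simp

lemma insertion_power: "insertion f (x ^ n) = insertion f x ^ n"
  by (induction n) (simp_all add: insertion_mult)

lemma insertion_diff: "insertion f (p - q) = insertion f p - insertion f q"
  using insertion_add[of f "p - q" q] by simp

lemma insertion_Var [simp]: "insertion f (Var i) = f i"
proof -
  have "(\<Prod>v\<in>UNIV. f v ^ Poly_Mapping.lookup (Poly_Mapping.single i 1) v) =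
      (\<Prod>v\<in>UNIV. if v = i then f v else 1)"
    by (rule prod.cong) (auto simp: lookup_single when_def)
  then show ?thesis
    by (simp add: Var_def insertion_single)
qed

lemma Var_power: "Var i ^ n = Poly_Mapping.single (Poly_Mapping.single i n) 1"
  by (induction n) (simp_all add: Var_def mult_single flip: single_add)

lemma prod_single_1:
  "(\<Prod>x\<in>A. Poly_Mapping.single (g x) 1) =
    Poly_Mapping.single (\<Sum>x\<in>A. g x :: 'b::comm_monoid_add) (1::int)"
  by (induction A rule: infinite_finite_induct) (simp_all add: mult_single)

lemma single_eq_prod_Var:
  fixes m :: "'m::finite \<Rightarrow>\<^sub>0 nat"
  shows "Poly_Mapping.single m c = of_int c * (\<Prod>v\<in>UNIV. Var v ^ Poly_Mapping.lookup m v)"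
proof -
  have "(\<Sum>v\<in>UNIV. Poly_Mapping.single v (Poly_Mapping.lookup m v)) = m"
    by (rule poly_mapping_eqI) (simp add: lookup_sum lookup_single when_def)
  then show ?thesis
    by (simp add: Var_power prod_single_1 mult_single flip: single_of_int)
qed

section \<open>Substitution for one variable and linear factors\<close>

lemma dvd_prod_diff:
  fixes q :: "'a::comm_ring_1"
  assumes "\<And>v. v \<in> A \<Longrightarrow> q dvd F v - G v"
  shows "q dvd prod F A - prod G A"
  using assms
proof (induction A rule: infinite_finite_induct)
  case (insert x A)
  have "prod F (insert x A) - prod G (insert x A) =
      F x * (prod F A - prod G A) + (F x - G x) * prod G A"
    using insert.hyps by (simp add: algebra_simps)
  moreover have "q dvd prod F A - prod G A" "q dvd F x - G x"
    using insert by auto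
  ultimately show ?case
    by simp
qed auto

lemma dvd_power_diff:
  fixes q :: "'a::comm_ring_1"
  assumes "q dvd x - y"
  shows "q dvd x ^ n - y ^ n"
  using dvd_prod_diff[of "{..<n}" q "\<lambda>_. x" "\<lambda>_. y"] assms by simp

text \<open>Modulo \<open>Var i - g\<close> the variable and its substitute agree, hence so do their
  powers and products; monomials suffice by additivity.\<close>

lemma dvd_diff_insertion:
  fixes p :: "'m::finite int_mpoly"
  shows "Var i - g dvd p - insertion (Var(i := g)) p"
proof (induction p rule: int_mpoly_induct)
  case (single m c)
  have "Var i - g dvd (\<Prod>v\<in>UNIV. Var v ^ Poly_Mapping.lookup m v) -
      (\<Prod>v\<in>UNIV. (Var(i := g)) v ^ Poly_Mapping.lookup m v)"
    by (intro dvd_prod_diff dvd_power_diff) auto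
  then show ?case
    unfolding insertion_single unfolding single_eq_prod_Var right_diff_distrib[symmetric]
    by (rule dvd_mult)
next
  case (add p q)
  then have "Var i - g dvd (p - insertion (Var(i := g)) p) + (q - insertion (Var(i := g)) q)"
    by (rule dvd_add)
  then show ?case
    by (simp only: insertion_add add_diff_add)
qed

text \<open>A factor theorem. If the substitution fixes \<open>g\<close>, it kills
  \<open>Var i - g\<close>, whose multiples are then exactly its kernel.\<close>

lemma Var_diff_dvd_iff:
  fixes p :: "'m::finite int_mpoly"
  assumes "insertion (Var(i := g)) g = g"
  shows "Var i - g dvd p \<longleftrightarrow> insertion (Var(i := g)) p = 0"
proof
  assume "Var i - g dvd p"
  then show "insertion (Var(i := g)) p = 0"
    by (auto simp: insertion_mult insertion_diff assms elim!: dvdE)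
next
  assume "insertion (Var(i := g)) p = 0"
  then show "Var i - g dvd p"
    using dvd_diff_insertion[of i g p] by simp
qed

lemma Var_eq_iff [simp]: "Var i = Var j \<longleftrightarrow> i = j"
proof
  assume "Var i = Var j"
  then have "Poly_Mapping.keys (Var i) = Poly_Mapping.keys (Var j)"
    by simp
  then have "Poly_Mapping.keys (Poly_Mapping.single i (1::nat)) = Poly_Mapping.keys (Poly_Mapping.single j (1::nat))"
    by (simp add: Var_def)
  then show "i = j"
    by simp
qed simp

lemma Var_neq_0 [simp]: "Var i \<noteq> 0"
proof
  assume "Var i = 0"
  then have "Poly_Mapping.lookup (Var i) (Poly_Mapping.single i 1) = 0"
    by simp
  then show False
    by (simp add: Var_def)
qed

text \<open>The kernel of a homomorphism into a domain is a prime ideal. The linear order on the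
  variables orders the exponent vectors, which makes the ring a domain.\<close>

lemma prime_elem_Var_diff:
  fixes g :: "'m::{finite,linorder} int_mpoly"
  assumes "insertion (Var(i := g)) g = g" "Var i \<noteq> g"
  shows "prime_elem (Var i - g)"
  by (rule prime_elemI) (use assms in \<open>auto simp: Var_diff_dvd_iff insertion_mult\<close>)

lemma Var_dvd_iff: "Var i dvd p \<longleftrightarrow> insertion (Var(i := 0)) p = 0"
  using Var_diff_dvd_iff[of i 0 p] by simp

lemma prime_elem_Var: "prime_elem (Var i :: 'm::{finite,linorder} int_mpoly)"
  using prime_elem_Var_diff[of i 0] by simp

subsection \<open>Determinants with confluent rows\<close>

lemma Sum_lessThan_choose: "\<Sum>{..<n} = n choose 2"
  by (induction n) (simp_all add: numeral_2_eq_2)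

lemma Max_ge_card:
  fixes S :: "nat set"
  assumes "finite S" "S \<noteq> {}" "\<And>x. x \<in> S \<Longrightarrow> b \<le> x"
  shows "b + card S \<le> Suc (Max S)"
proof -
  have "card S \<le> card {b..Max S}"
    by (rule card_mono) (use assms in auto)
  moreover have "b \<le> Max S"
    using assms by simp
  ultimately show ?thesis
    by simp
qed

text \<open>Remove the maximum, which is at least \<open>b + (card S - 1)\<close>, and use
  induction. The sets in question consist of exponents of one prime.\<close>

lemma sum_distinct_nat_ge:
  fixes S :: "nat set"
  assumes "finite S" "\<And>x. x \<in> S \<Longrightarrow> b \<le> x"
  shows "(\<Sum>a<card S. b + a) \<le> \<Sum>S"
  using assms
proof (induction "card S" arbitrary: S)
  case (Suc k)
  then have ne: "S \<noteq> {}"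
    by auto
  define R where "R = S - {Max S}"
  have R: "card R = k" "finite R"
    using Suc ne by (auto simp: R_def)
  have "(\<Sum>a<k. b + a) \<le> \<Sum>R"
    using Suc.hyps(1)[of R] R Suc.prems by (auto simp: R_def)
  moreover have "\<Sum>S = Max S + \<Sum>R"
    using Suc.prems(1) ne by (simp add: R_def sum.remove[of S "Max S"])
  moreover have "b + k \<le> Max S"
    using Max_ge_card[OF Suc.prems(1) ne Suc.prems(2)] Suc.hyps(2) by simp
  ultimately show ?case
    by (simp flip: Suc.hyps(2))
qed simp

text \<open>Equality case of the bound: the elements other than the maximum already use up so much
  of the sum that the maximum lies below \<open>card S\<close>.\<close>

lemma eq_lessThan_if_sum_le:
  fixes S :: "nat set"
  assumes "finite S" "\<Sum>S \<le> \<Sum>{..<card S}"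
  shows "S = {..<card S}"
proof (cases "S = {}")
  case False
  define R where "R = S - {Max S}"
  have c: "card S = Suc (card R)"
    using False assms(1) by (simp add: R_def card_gt_0_iff)
  have "\<Sum>{..<card R} \<le> \<Sum>R"
    using sum_distinct_nat_ge[of R 0] assms by (simp add: R_def)
  moreover have "\<Sum>S = Max S + \<Sum>R"
    using False assms(1) by (simp add: R_def sum.remove[of S "Max S"])
  ultimately have "Max S < card S"
    using assms(2) by (simp add: c)
  then have "S \<subseteq> {..<card S}"
    using assms(1) Max_ge le_less_trans by blast
  then show ?thesis
    by (simp add: card_subset_eq)
qed simp

text \<open>Multilinearity in the rows, read off the Leibniz formula: \<open>f\<close> records which
  generator is chosen in each row.\<close>

lemma det_rows_combination:
  fixes U :: "nat \<Rightarrow> 'e \<Rightarrow> 'a::comm_ring_1"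
  assumes "finite E" and A: "A \<in> carrier_mat n n"
    and "\<And>r c. r < n \<Longrightarrow> c < n \<Longrightarrow> A $$ (r, c) = (\<Sum>e\<in>E. U r e * W e c)"
  shows "det A = (\<Sum>f\<in>{0..<n} \<rightarrow>\<^sub>E E.
    (\<Prod>r=0..<n. U r (f r)) * det (mat n n (\<lambda>(r, c). W (f r) c)))"
proof -
  have "(\<Prod>r=0..<n. A $$ (r, p r)) =
      (\<Sum>f\<in>{0..<n} \<rightarrow>\<^sub>E E. (\<Prod>r=0..<n. U r (f r)) * (\<Prod>r=0..<n. W (f r) (p r)))"
    if "p permutes {0..<n}" for p
  proof -
    have "(\<Prod>r=0..<n. A $$ (r, p r)) = (\<Prod>r=0..<n. \<Sum>e\<in>E. U r e * W e (p r))"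
      using that assms(3) permutes_in_image[OF that] by (intro prod.cong) auto
    then show ?thesis
      by (simp add: prod_sum_PiE assms(1) prod.distrib)
  qed
  then have "det A = (\<Sum>p | p permutes {0..<n}. \<Sum>f\<in>{0..<n} \<rightarrow>\<^sub>E E.
      signof p * ((\<Prod>r=0..<n. U r (f r)) * (\<Prod>r=0..<n. W (f r) (p r))))"
    unfolding det_def'[OF A] by (simp add: sum_distrib_left)
  also have "\<dots> = (\<Sum>f\<in>{0..<n} \<rightarrow>\<^sub>E E. \<Sum>p | p permutes {0..<n}.
      signof p * ((\<Prod>r=0..<n. U r (f r)) * (\<Prod>r=0..<n. W (f r) (p r))))"
    by (rule sum.swap)
  also have "\<dots> = (\<Sum>f\<in>{0..<n} \<rightarrow>\<^sub>E E.
      (\<Prod>r=0..<n. U r (f r)) * det (mat n n (\<lambda>(r, c). W (f r) c)))"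
  proof (rule sum.cong[OF refl])
    fix f
    have "(\<Prod>r=0..<n. mat n n (\<lambda>(r, c). W (f r) c) $$ (r, p r)) = (\<Prod>r=0..<n. W (f r) (p r))"
      if "p permutes {0..<n}" for p
      using permutes_in_image[OF that] by (intro prod.cong) auto
    then show "(\<Sum>p | p permutes {0..<n}.
        signof p * ((\<Prod>r=0..<n. U r (f r)) * (\<Prod>r=0..<n. W (f r) (p r)))) =
      (\<Prod>r=0..<n. U r (f r)) * det (mat n n (\<lambda>(r, c). W (f r) c))"
      by (subst det_def'[of _ n]) (auto simp: sum_distrib_left mult_ac intro!: sum.cong)
  qed
  finally show ?thesis .
qed

text \<open>A choice that repeats a generator yields two equal rows, so only injective choices with
  nonzero coefficient have to be tested.\<close>

lemma dvd_det_rows_combination: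
  fixes U :: "nat \<Rightarrow> 'e \<Rightarrow> 'a::comm_ring_1"
  assumes "finite E" "A \<in> carrier_mat n n"
    and "\<And>r c. r < n \<Longrightarrow> c < n \<Longrightarrow> A $$ (r, c) = (\<Sum>e\<in>E. U r e * W e c)"
    and "\<And>f. inj_on f {0..<n} \<Longrightarrow> (\<Prod>r=0..<n. U r (f r)) \<noteq> 0 \<Longrightarrow> d dvd (\<Prod>r=0..<n. U r (f r))"
  shows "d dvd det A"
  unfolding det_rows_combination[OF assms(1,2,3), simplified]
proof (rule dvd_sum)
  fix f assume "f \<in> {0..<n} \<rightarrow>\<^sub>E E"
  show "d dvd (\<Prod>r=0..<n. U r (f r)) * det (mat n n (\<lambda>(r, c). W (f r) c))"
  proof (cases "inj_on f {0..<n}")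
    case True
    then show ?thesis
      using assms(4)[of f] by (cases "(\<Prod>r=0..<n. U r (f r)) = 0") auto
  next
    case False
    then obtain i j where "i < n" "j < n" "i \<noteq> j" "f i = f j"
      by (auto simp: inj_on_def)
    then have "det (mat n n (\<lambda>(r, c). W (f r) c)) = 0"
      by (intro det_identical_rows[of _ n i j]) auto
    then show ?thesis
      by simp
  qed
qed

text \<open>Expand each row \<open>p a\<close> along the rows \<open>w e\<close>. The choices repeating a row contribute a
  vanishing determinant, and the rows \<open>w e\<close> with \<open>e < k\<close> already occur as \<open>q e\<close>, so the
  surviving choices assign to the \<open>a < k\<close> distinct exponents \<open>e\<^sub>a \<ge> k\<close>, and
  \<open>\<Sum>(e\<^sub>a - a) \<ge> k\<^sup>2\<close>.\<close>

lemma power_dvd_det_confluent: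
  fixes t :: "'a::comm_ring_1"
  assumes A: "A \<in> carrier_mat n n"
    and p: "inj_on p {..<k}" "p ` {..<k} \<subseteq> {..<n}"
    and q: "inj_on q {..<k}" "q ` {..<k} \<subseteq> {..<n}"
    and disj: "p ` {..<k} \<inter> q ` {..<k} = {}"
    and rows_p: "\<And>a c. a < k \<Longrightarrow> c < n \<Longrightarrow>
      A $$ (p a, c) = (\<Sum>e\<le>B. of_nat (e choose a) * t ^ (e - a) * w e c)"
    and rows_q: "\<And>a c. a < k \<Longrightarrow> c < n \<Longrightarrow> A $$ (q a, c) = w a c"
    and kB: "k \<le> Suc B"
  shows "t ^ k\<^sup>2 dvd det A"
proof -
  \<comment> \<open>\<open>Inl e\<close> stands for the row \<open>w e\<close>, and
    \<open>Inr r\<close> for row \<open>r\<close> of \<open>A\<close> itself, which is needed for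
    the rows outside both families.\<close>
  define E where "E = {..B} <+> {..<n}"
  define W where "W = case_sum w (\<lambda>r c. A $$ (r, c))"
  define U :: "nat \<Rightarrow> nat + nat \<Rightarrow> 'a" where
    "U r s = (if r \<in> p ` {..<k} then
        (case s of Inl e \<Rightarrow> let a = inv_into {..<k} p r in of_nat (e choose a) * t ^ (e - a)
         | Inr _ \<Rightarrow> 0)
      else of_bool (s = (if r \<in> q ` {..<k} then Inl (inv_into {..<k} q r) else Inr r)))" for r s
  have Up: "U (p a) s = (case s of Inl e \<Rightarrow> of_nat (e choose a) * t ^ (e - a) | Inr _ \<Rightarrow> 0)"
    if "a < k" for a s
    using that p(1) by (auto simp: U_def Let_def split: sum.splits)
  have Uq: "U (q a) s = of_bool (s = Inl a)" if "a < k" for a s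
    using that q(1) disj by (auto simp: U_def)
  have Uo: "U r s = of_bool (s = Inr r)" if "r \<notin> p ` {..<k}" "r \<notin> q ` {..<k}" for r s
    using that by (auto simp: U_def)
  have Wsimps: "W (Inl e) c = w e c" "W (Inr r) c = A $$ (r, c)" for e r c
    by (simp_all add: W_def)
  have finE: "finite E"
    by (simp add: E_def)
  have "A $$ (r, c) = (\<Sum>e\<in>E. U r e * W e c)" if "r < n" "c < n" for r c
  proof -
    consider a where "a < k" "r = p a" | a where "a < k" "r = q a"
      | "r \<notin> p ` {..<k}" "r \<notin> q ` {..<k}"
      by auto
    then show ?thesis
    proof cases
      case 1
      then show ?thesis
        using that by (simp add: Up rows_p E_def sum.Plus Wsimps)
    next
      case (2 a)
      have "(\<Sum>e\<in>E. U r e * W e c) = (\<Sum>e\<in>E. if e = Inl a then W e c else 0)"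
        by (rule sum.cong) (auto simp: 2 Uq)
      \<comment> \<open>\<open>k \<le> Suc B\<close> ensures that \<open>Inl a\<close> lies in
        \<open>E\<close>.\<close>
      then show ?thesis
        using that kB 2 finE by (auto simp: rows_q Wsimps E_def)
    next
      case 3
      have "(\<Sum>e\<in>E. U r e * W e c) = (\<Sum>e\<in>E. if e = Inr r then W e c else 0)"
        by (rule sum.cong) (auto simp: 3 Uo)
      then show ?thesis
        using that finE by (auto simp: Wsimps E_def)
    qed
  qed
  then show ?thesis
  proof (rule dvd_det_rows_combination[OF finE A])
    fix f
    assume inj: "inj_on f {0..<n}" and nz: "(\<Prod>r=0..<n. U r (f r)) \<noteq> 0"
    have nz': "U r (f r) \<noteq> 0" if "r < n" for r
      using that nz by (metis atLeastLessThan_iff finite_atLeastLessThan le0 prod_zero)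
    have pn: "p a < n" and qn: "q a < n" if "a < k" for a
      using that p q by auto
    have fq: "f (q a) = Inl a" if "a < k" for a
      using nz'[OF qn[OF that]] Uq[OF that] by (auto split: if_splits)
    have "\<exists>e. f (p a) = Inl e \<and> a \<le> e" if "a < k" for a
      using nz'[OF pn[OF that]] Up[OF that]
      by (cases "f (p a)") (auto simp: not_less[symmetric] binomial_eq_0)
    then obtain e where e: "\<And>a. a < k \<Longrightarrow> f (p a) = Inl (e a)" "\<And>a. a < k \<Longrightarrow> a \<le> e a"
      by metis
    have inje: "inj_on e {..<k}"
    proof (rule inj_onI)
      fix a b assume "a \<in> {..<k}" "b \<in> {..<k}" "e a = e b"
      then have "f (p a) = f (p b)" "a < k" "b < k"
        using e(1) by auto
      then have "p a = p b"
        using inj pn by (auto dest: inj_onD)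
      then show "a = b"
        using p(1) \<open>a < k\<close> \<open>b < k\<close> by (auto dest: inj_onD)
    qed
    have ek: "k \<le> e a" if "a < k" for a
    proof (rule ccontr)
      assume "\<not> k \<le> e a"
      then have *: "e a < k"
        by simp
      then have "f (p a) = f (q (e a))"
        using that e(1) fq by simp
      then have "p a = q (e a)"
        using inj pn[OF that] qn[OF *] by (auto dest: inj_onD)
      then show False
        using disj that * by auto
    qed
    \<comment> \<open>Adding \<open>\<Sum>a<k. a\<close> turns the claim on the differences
      \<open>e a - a\<close> into a bound for \<open>k\<close> distinct values that are all at least
      \<open>k\<close>.\<close>
    have "k\<^sup>2 + (\<Sum>a<k. a) = (\<Sum>a<k. k + a)"
      by (simp add: sum.distrib power2_eq_square)
    also have "\<dots> \<le> (\<Sum>a<k. e a)"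
      using sum_distinct_nat_ge[of "e ` {..<k}" k] ek inje
      by (auto simp: card_image sum.reindex)
    also have "\<dots> = (\<Sum>a<k. e a - a) + (\<Sum>a<k. a)"
      using e(2) by (simp flip: sum.distrib)
    finally have "t ^ k\<^sup>2 dvd (\<Prod>a<k. t ^ (e a - a))"
      by (simp add: le_imp_power_dvd flip: power_sum)
    also have "\<dots> dvd (\<Prod>a<k. U (p a) (f (p a)))"
      by (intro prod_dvd_prod) (simp add: Up e)
    also have "\<dots> = (\<Prod>r\<in>p ` {..<k}. U r (f r))"
      using p(1) by (simp add: prod.reindex)
    also have "\<dots> dvd (\<Prod>r=0..<n. U r (f r))"
      using p(2) by (intro prod_dvd_prod_subset) auto
    finally show "t ^ k\<^sup>2 dvd (\<Prod>r=0..<n. U r (f r))" .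
  qed
qed

lemma det_scale_rows:
  fixes A :: "'a::comm_ring_1 mat"
  assumes A: "A \<in> carrier_mat n n"
  shows "det (mat n n (\<lambda>(r, c). s r * A $$ (r, c))) = (\<Prod>r=0..<n. s r) * det A"
proof -
  have "(\<Prod>r=0..<n. mat n n (\<lambda>(r, c). s r * A $$ (r, c)) $$ (r, p r)) =
      (\<Prod>r=0..<n. s r) * (\<Prod>r=0..<n. A $$ (r, p r))" if "p permutes {0..<n}" for p
    using permutes_in_image[OF that] by (simp flip: prod.distrib)
  then show ?thesis
    unfolding det_def'[OF A]
    by (subst det_def'[of _ n]) (auto simp: sum_distrib_left mult_ac intro!: sum.cong)
qed

text \<open>Taylor expansion at \<open>y\<close> of the \<open>a\<close>-th Hasse derivative of the
  \<open>n\<close>-th power: regroup the binomial coefficients and expand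
  \<open>((x - y) + y) ^ (n - a)\<close>. The bound \<open>B\<close> lets columns with different
  \<open>n\<close> share one range of summation.\<close>

lemma binomial_taylor:
  fixes x y :: "'a::comm_ring_1"
  assumes "n \<le> B"
  shows "of_nat (n choose a) * x ^ (n - a) =
    (\<Sum>e\<le>B. of_nat (e choose a) * (x - y) ^ (e - a) * (of_nat (n choose e) * y ^ (n - e)))"
proof (cases "a \<le> n")
  case True
  have "(\<Sum>e\<le>B. of_nat (e choose a) * (x - y) ^ (e - a) * (of_nat (n choose e) * y ^ (n - e))) =
      (\<Sum>e=a..n. of_nat (e choose a) * (x - y) ^ (e - a) * (of_nat (n choose e) * y ^ (n - e)))"
    by (rule sum.mono_neutral_right) (use assms in \<open>auto simp: not_le binomial_eq_0\<close>)
  also have "\<dots> = (\<Sum>e=a..n. of_nat (n choose a) *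
      (of_nat ((n - a) choose (e - a)) * (x - y) ^ (e - a) * y ^ (n - e)))"
  proof (rule sum.cong[OF refl])
    fix e assume "e \<in> {a..n}"
    then have "of_nat (n choose e) * of_nat (e choose a) =
        (of_nat (n choose a) * of_nat ((n - a) choose (e - a)) :: 'a)"
      using choose_mult[of a e n] by (simp flip: of_nat_mult)
    then have "of_nat (n choose a) *
        (of_nat ((n - a) choose (e - a)) * (x - y) ^ (e - a) * y ^ (n - e)) =
        (of_nat (n choose e) * of_nat (e choose a)) * ((x - y) ^ (e - a) * y ^ (n - e))"
      by (simp only: mult.assoc)
    then show "of_nat (e choose a) * (x - y) ^ (e - a) * (of_nat (n choose e) * y ^ (n - e)) =
        of_nat (n choose a) * (of_nat ((n - a) choose (e - a)) * (x - y) ^ (e - a) * y ^ (n - e))"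
      by (simp only: mult_ac)
  qed
  also have "\<dots> = of_nat (n choose a) *
      (\<Sum>b\<le>n - a. of_nat ((n - a) choose b) * (x - y) ^ b * y ^ (n - a - b))"
    unfolding sum_distrib_left
    by (rule sum.reindex_bij_witness[of _ "\<lambda>b. b + a" "\<lambda>e. e - a"]) (use True in auto)
  also have "\<dots> = of_nat (n choose a) * x ^ (n - a)"
    using binomial_ring[of "x - y" y "n - a"] by simp
  finally show ?thesis ..
next
  case False
  then have "(e choose a) = 0 \<or> (n choose e) = 0" for e
    by (cases "e < a") auto
  then have "of_nat (e choose a) * (x - y) ^ (e - a) * (of_nat (n choose e) * y ^ (n - e)) = 0" for e
    by (metis mult_zero_left mult_zero_right of_nat_0)
  then show ?thesis
    using False by (simp add: binomial_eq_0 not_le)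
qed

subsection \<open>Divisors of the minors\<close>

lemma set_row_index: "set (row_index \<nu>) = {(j, i). 1 \<le> i \<and> i \<le> \<nu> j}"
  by (auto simp: row_index_def image_iff simp del: upt_Suc)

lemma distinct_row_index: "distinct (row_index \<nu>)"
proof -
  have "distinct (concat (map (\<lambda>j. map (Pair j) [1..<Suc (\<nu> j)]) js))" if "distinct js" for js
    using that by (induction js) (auto simp: distinct_map inj_on_def)
  then show ?thesis
    by (simp add: row_index_def)
qed

lemma length_row_index: "length (row_index \<nu>) = (\<Sum>j\<in>UNIV. \<nu> j)"
proof -
  have "length (row_index \<nu>) = card (set (row_index \<nu>))"
    by (simp add: distinct_card distinct_row_index)
  also have "set (row_index \<nu>) = (SIGMA j:UNIV. {1..\<nu> j})"
    by (auto simp: set_row_index)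
  finally show ?thesis
    by simp
qed

text \<open>Makes the blocks consecutive intervals of rows, as the block structure of the nonzero
  minor requires.\<close>

lemma sorted_fst_row_index: "sorted (map fst (row_index \<nu>))"
proof -
  have "sorted (map fst (concat (map (\<lambda>j. map (Pair j) [1..<Suc (\<nu> j)]) js)))"
    if "sorted js" for js
    using that by (induction js) (auto simp: sorted_append comp_def sorted_wrt_map)
  then show ?thesis
    by (simp add: row_index_def)
qed

definition row_of :: "('m::{finite,linorder} \<Rightarrow> nat) \<Rightarrow> 'm \<Rightarrow> nat \<Rightarrow> nat" where
  "row_of \<nu> j i = inv_into {..<length (row_index \<nu>)} ((!) (row_index \<nu>)) (j, i)"

lemma row_of:
  assumes "1 \<le> i" "i \<le> \<nu> j"
  shows "row_index \<nu> ! row_of \<nu> j i = (j, i)" and "row_of \<nu> j i < (\<Sum>j\<in>UNIV. \<nu> j)"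
proof -
  have "(j, i) \<in> set (row_index \<nu>)"
    using assms by (simp add: set_row_index)
  then have *: "(j, i) \<in> (!) (row_index \<nu>) ` {..<length (row_index \<nu>)}"
    by (metis imageI in_set_conv_nth lessThan_iff)
  show "row_index \<nu> ! row_of \<nu> j i = (j, i)"
    unfolding row_of_def by (rule f_inv_into_f[OF *])
  show "row_of \<nu> j i < (\<Sum>j\<in>UNIV. \<nu> j)"
    using inv_into_into[OF *] by (simp add: row_of_def length_row_index)
qed

lemma row_index_nth_bounds:
  assumes "r < (\<Sum>j\<in>UNIV. \<nu> j)" "row_index \<nu> ! r = (j, i)"
  shows "1 \<le> i" "i \<le> \<nu> j"
  using nth_mem[of r "row_index \<nu>"] assms by (auto simp: set_row_index length_row_index)

lemma row_of_row_index:
  assumes "r < (\<Sum>j\<in>UNIV. \<nu> j)" "row_index \<nu> ! r = (j, i)"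
  shows "row_of \<nu> j i = r"
  using nth_eq_iff_index_eq[OF distinct_row_index, of "row_of \<nu> j i" \<nu> r] assms
    row_of[of i \<nu> j] row_index_nth_bounds[OF assms]
  by (simp add: length_row_index)

lemma bij_betw_row_of:
  "bij_betw (row_of \<nu> j) {1..\<nu> j} {r. r < (\<Sum>j\<in>UNIV. \<nu> j) \<and> fst (row_index \<nu> ! r) = j}"
proof -
  have *: "1 \<le> snd (row_index \<nu> ! r) \<and> snd (row_index \<nu> ! r) \<le> \<nu> j \<and>
      row_of \<nu> j (snd (row_index \<nu> ! r)) = r"
    if "r < (\<Sum>j\<in>UNIV. \<nu> j)" "fst (row_index \<nu> ! r) = j" for r
  proof -
    have r: "row_index \<nu> ! r = (j, snd (row_index \<nu> ! r))"
      using that(2) by (simp add: prod_eq_iff)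
    show ?thesis
      using row_index_nth_bounds[OF that(1) r] row_of_row_index[OF that(1) r] by simp
  qed
  show ?thesis
    by (rule bij_betw_byWitness[where f' = "\<lambda>r. snd (row_index \<nu> ! r)"])
      (use * in \<open>auto simp: row_of\<close>)
qed

lemma V_mat_index:
  assumes "r < (\<Sum>j\<in>UNIV. \<nu> j)" "h \<le> (\<Sum>j\<in>UNIV. l j)" "row_index \<nu> ! r = (j, i)"
  shows "V_mat \<nu> l $$ (r, h) =
    of_nat (((\<Sum>j\<in>UNIV. l j) + i) choose h) * Var j ^ ((\<Sum>j\<in>UNIV. l j) - h)"
  using assms by (simp add: V_mat_def Let_def)

section \<open>Maximal minors as selections of columns\<close>

lemma pick_lessThan:
  assumes "i < n"
  shows "pick {..<n} i = i"
proof -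
  have "{a \<in> {..<n}. a < i} = {..<i}"
    using assms by auto
  then show ?thesis
    using pick_card_in_set[of i "{..<n}"] assms by simp
qed

definition col_minor :: "'a::comm_ring_1 mat \<Rightarrow> nat \<Rightarrow> (nat \<Rightarrow> nat) \<Rightarrow> 'a mat" where
  "col_minor A k g = mat k k (\<lambda>(r, c). A $$ (r, g c))"

text \<open>A minor of order \<open>dim_row A\<close> uses every row, so only the columns vary;
  \<open>g\<close> enumerates them in increasing order.\<close>

lemma minors_cases:
  assumes "x \<in> minors (dim_row A) A"
  obtains g where "inj_on g {..<dim_row A}" "\<And>c. c < dim_row A \<Longrightarrow> g c < dim_col A"
    "x = det (col_minor A (dim_row A) g)"
proof -
  obtain I J where IJ: "x = det (submatrix A I J)" "I \<subseteq> {..<dim_row A}" "J \<subseteq> {..<dim_col A}"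
    "card I = dim_row A" "card J = dim_row A"
    using assms by (auto simp: minors_def)
  then have I: "I = {..<dim_row A}"
    by (intro card_subset_eq) auto
  have cJ: "{j. j < dim_col A \<and> j \<in> J} = J"
    using IJ(3) by auto
  show thesis
  proof
    show "inj_on (pick J) {..<dim_row A}"
      by (rule strict_mono_on_imp_inj_on, rule strict_mono_onI)
        (use IJ(5) pick_mono_le in auto)
    show "pick J c < dim_col A" if "c < dim_row A" for c
      using pick_in_set_le[of c J] that IJ by auto
    show "x = det (col_minor A (dim_row A) (pick J))"
      by (auto simp: IJ(1) submatrix_def col_minor_def cJ IJ(5) I pick_lessThan
        intro!: arg_cong[where f = det])
  qed
qed

lemma col_minor_in_minors:
  assumes "dim_row A \<le> dim_col A"
  shows "det (col_minor A (dim_row A) id) \<in> minors (dim_row A) A"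
proof -
  have "{i. i < dim_col A \<and> i < dim_row A} = {..<dim_row A}"
    using assms by auto
  then have card: "card {i. i < dim_col A \<and> i < dim_row A} = dim_row A"
    by (simp only: card_lessThan)
  have "col_minor A (dim_row A) id = submatrix A {..<dim_row A} {..<dim_row A}"
    by (rule eq_matI) (simp_all add: col_minor_def submatrix_def pick_lessThan card)
  moreover have "{..<dim_row A} \<subseteq> {..<dim_col A}"
    using assms by auto
  ultimately show ?thesis
    unfolding minors_def by fastforce
qed

text \<open>Multiplied by \<open>x ^ (k - a)\<close> and a binomial coefficient, row \<open>k - a\<close> of a block becomes the
  \<open>a\<close>-th Hasse derivative of \<open>((L + k) choose h) * x ^ (L + k - h)\<close>.\<close>

lemma scaled_binomial:
  fixes x :: "'a::comm_ring_1"
  assumes "a \<le> k" "h \<le> L"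
  shows "of_nat ((L + k) choose a) * x ^ (k - a) * (of_nat ((L + (k - a)) choose h) * x ^ (L - h)) =
    (of_nat ((L + k) choose h) * (of_nat ((L + k - h) choose a) * x ^ (L + k - h - a)) :: 'a)"
proof -
  have "((L + k) choose (L + k - a)) * ((L + k - a) choose h) =
      ((L + k) choose h) * ((L + k - h) choose (L + k - a - h))"
    by (rule choose_mult) (use assms in auto)
  moreover have "(L + k) choose (L + k - a) = (L + k) choose a"
    using binomial_symmetric[of a "L + k"] assms by simp
  moreover have "(L + k - h) choose (L + k - a - h) = (L + k - h) choose a"
    using binomial_symmetric[of a "L + k - h"] assms by (simp add: add.commute)
  ultimately have "((L + k) choose a) * ((L + (k - a)) choose h) =
      ((L + k) choose h) * ((L + k - h) choose a)"
    using assms(1) by simp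
  then have *: "of_nat ((L + k) choose a) * of_nat ((L + (k - a)) choose h) =
      (of_nat ((L + k) choose h) * of_nat ((L + k - h) choose a) :: 'a)"
    by (metis of_nat_mult)
  have "k - a + (L - h) = L + k - h - a"
    using assms by simp
  then have "x ^ (k - a) * x ^ (L - h) = x ^ (L + k - h - a)"
    by (simp flip: power_add)
  then have "of_nat ((L + k) choose h) * (of_nat ((L + k - h) choose a) * x ^ (L + k - h - a)) =
      (of_nat ((L + k) choose a) * of_nat ((L + (k - a)) choose h)) * (x ^ (k - a) * x ^ (L - h))"
    by (simp only: * mult.assoc)
  then show ?thesis
    by (simp only: mult_ac)
qed

context
  fixes \<nu> l :: "'m::{finite,linorder} \<Rightarrow> nat" and M L :: nat and g :: "nat \<Rightarrow> nat"
  defines "M \<equiv> (\<Sum>j\<in>UNIV. \<nu> j)" and "L \<equiv> (\<Sum>j\<in>UNIV. l j)"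
  assumes g: "inj_on g {..<M}" "\<And>c. c < M \<Longrightarrow> g c \<le> L"
begin

text \<open>In a Leibniz term the rows of block \<open>j\<close> meet distinct columns, so the
  exponents of \<open>Var j\<close> sum to at least
  \<open>0 + 1 + \<dots> + (\<nu> j - 1)\<close>.\<close>

lemma Var_power_dvd_minor: "Var j ^ (\<nu> j choose 2) dvd det (col_minor (V_mat \<nu> l) M g)"
proof -
  let ?A = "col_minor (V_mat \<nu> l) M g"
  define R where "R = {r. r < M \<and> fst (row_index \<nu> ! r) = j}"
  have R: "finite R" "R \<subseteq> {0..<M}" "card R = \<nu> j"
    using bij_betw_same_card[OF bij_betw_row_of[of \<nu> j]] by (auto simp: R_def M_def)
  have "Var j ^ (\<nu> j choose 2) dvd (\<Prod>r=0..<M. ?A $$ (r, p r))" if p: "p permutes {0..<M}" for p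
  proof -
    define e where "e r = L - g (p r)" for r
    have pM: "p r < M" if "r < M" for r
      using permutes_in_image[OF p] that by simp
    have "inj_on e R"
    proof (rule inj_onI)
      fix r s assume "r \<in> R" "s \<in> R" "e r = e s"
      \<comment> \<open>Truncated subtraction from \<open>L\<close> is injective here because all
        selected columns are at most \<open>L\<close>.\<close>
      then have rs: "r < M" "s < M" and "g (p r) = g (p s)"
        using g(2)[OF pM[of r]] g(2)[OF pM[of s]] by (auto simp: R_def e_def)
      then have "p r = p s"
        using g(1) pM by (auto dest: inj_onD)
      then show "r = s"
        using permutes_inj[OF p] by (auto dest: injD)
    qed
    then have "\<nu> j choose 2 \<le> (\<Sum>r\<in>R. e r)"
      using sum_distinct_nat_ge[of "e ` R" 0] R
      by (simp add: card_image sum.reindex Sum_lessThan_choose)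
    then have "Var j ^ (\<nu> j choose 2) dvd (\<Prod>r\<in>R. Var j ^ e r)"
      by (simp add: le_imp_power_dvd flip: power_sum)
    also have "\<dots> dvd (\<Prod>r\<in>R. ?A $$ (r, p r))"
    proof (rule prod_dvd_prod)
      fix r assume "r \<in> R"
      then obtain i where "r < M" "row_index \<nu> ! r = (j, i)"
        by (auto simp: R_def prod_eq_iff)
      then show "Var j ^ e r dvd ?A $$ (r, p r)"
        using V_mat_index[of r \<nu> "g (p r)" l j i] pM g(2)
        by (simp add: col_minor_def e_def M_def L_def)
    qed
    also have "\<dots> dvd (\<Prod>r=0..<M. ?A $$ (r, p r))"
      by (rule prod_dvd_prod_subset) (use R in auto)
    finally show ?thesis .
  qed
  then show ?thesis
    by (subst det_def'[of _ M]) (auto simp: col_minor_def intro!: dvd_sum dvd_mult)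
qed

text \<open>Scaling rows produces a matrix \<open>B\<close> with confluent rows. The scale factors
  are prime to \<open>Var i - Var j\<close>, so the power passes from \<open>det B\<close> back to
  the minor.\<close>

lemma Var_diff_power_dvd_minor:
  assumes "i \<noteq> j"
  shows "(Var i - Var j) ^ (min (\<nu> i) (\<nu> j))\<^sup>2 dvd det (col_minor (V_mat \<nu> l) M g)"
proof -
  let ?A = "col_minor (V_mat \<nu> l) M g"
  define k where "k = min (\<nu> i) (\<nu> j)"
  \<comment> \<open>The factor of \<open>scaled_binomial\<close> with \<open>a = k - m\<close>: the
    derivatives of orders 0 to \<open>k - 1\<close> sit in rows \<open>k\<close> down to 1 of a
    block.\<close>
  define s :: "nat \<Rightarrow> 'm int_mpoly" where "s r = (case row_index \<nu> ! r of (b, m) \<Rightarrow>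
      if b \<in> {i, j} \<and> m \<le> k then of_nat ((L + k) choose (k - m)) * Var b ^ m else 1)" for r
  \<comment> \<open>The \<open>e\<close>-th Hasse derivative at \<open>Var j\<close> of the
    polynomial attached to column \<open>g c\<close>.\<close>
  define w :: "nat \<Rightarrow> nat \<Rightarrow> 'm int_mpoly" where
    "w e c = of_nat ((L + k) choose g c) *
      (of_nat ((L + k - g c) choose e) * Var j ^ (L + k - g c - e))" for e c
  define B where "B = mat M M (\<lambda>(r, c). s r * ?A $$ (r, c))"
  have row_lt: "row_of \<nu> b (k - a) < M" if "b \<in> {i, j}" "a < k" for a b
    using row_of(2)[of "k - a" \<nu> b] that by (auto simp: k_def M_def)
  have row_nth: "row_index \<nu> ! row_of \<nu> b (k - a) = (b, k - a)" if "b \<in> {i, j}" "a < k" for a b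
    using row_of(1)[of "k - a" \<nu> b] that by (auto simp: k_def)
  have B_row: "B $$ (row_of \<nu> b (k - a), c) = of_nat ((L + k) choose g c) *
      (of_nat ((L + k - g c) choose a) * Var b ^ (L + k - g c - a))"
    if "b \<in> {i, j}" "a < k" "c < M" for a b c
  proof -
    have "?A $$ (row_of \<nu> b (k - a), c) = of_nat ((L + (k - a)) choose g c) * Var b ^ (L - g c)"
      using V_mat_index[of "row_of \<nu> b (k - a)" \<nu> "g c" l b "k - a"]
        that row_lt[OF that(1,2)] row_nth[OF that(1,2)] g(2)
      by (simp add: col_minor_def M_def L_def)
    moreover have "s (row_of \<nu> b (k - a)) = of_nat ((L + k) choose a) * Var b ^ (k - a)"
      using that by (simp add: s_def row_nth)
    ultimately have "B $$ (row_of \<nu> b (k - a), c) = of_nat ((L + k) choose a) * Var b ^ (k - a) *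
        (of_nat ((L + (k - a)) choose g c) * Var b ^ (L - g c))"
      using row_lt[OF that(1,2)] that(3) by (simp add: B_def)
    also have "\<dots> = of_nat ((L + k) choose g c) *
      (of_nat ((L + k - g c) choose a) * Var b ^ (L + k - g c - a))"
      by (rule scaled_binomial) (use that g(2) in auto)
    finally show ?thesis .
  qed
  have inj: "inj_on (\<lambda>a. row_of \<nu> b (k - a)) {..<k}" if "b \<in> {i, j}" for b
  proof (rule inj_onI)
    fix x y assume xy: "x \<in> {..<k}" "y \<in> {..<k}" "row_of \<nu> b (k - x) = row_of \<nu> b (k - y)"
    then have "(b, k - x) = (b, k - y)"
      using row_nth[OF that] by (metis lessThan_iff)
    then have "k - x = k - y"
      by (rule Pair_inject)
    then show "x = y"
      using xy(1,2) unfolding lessThan_iff by linarith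
  qed
  have "(Var i - Var j) ^ k\<^sup>2 dvd det B"
  proof (rule power_dvd_det_confluent[where B = "L + k" and w = w])
    show "(\<lambda>a. row_of \<nu> i (k - a)) ` {..<k} \<inter> (\<lambda>a. row_of \<nu> j (k - a)) ` {..<k} = {}"
    proof (intro equals0I)
      fix x assume "x \<in> (\<lambda>a. row_of \<nu> i (k - a)) ` {..<k} \<inter> (\<lambda>a. row_of \<nu> j (k - a)) ` {..<k}"
      then obtain a a' where "a < k" "x = row_of \<nu> i (k - a)" "a' < k" "x = row_of \<nu> j (k - a')"
        by blast
      then have "(i, k - a) = (j, k - a')"
        using row_nth[of i a] row_nth[of j a'] by (metis insertI1 insertI2)
      with assms show False
        by simp
    qed
    fix a c assume ac: "a < k" "c < M"
    show "B $$ (row_of \<nu> j (k - a), c) = w a c"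
      using B_row[of j a c] ac by (simp add: w_def)
    have "of_nat ((L + k - g c) choose a) * Var i ^ (L + k - g c - a) =
      (\<Sum>e\<le>L + k. of_nat (e choose a) * (Var i - Var j) ^ (e - a) *
        (of_nat ((L + k - g c) choose e) * Var j ^ (L + k - g c - e)))"
      by (rule binomial_taylor) simp
    then have "B $$ (row_of \<nu> i (k - a), c) = of_nat ((L + k) choose g c) *
      (\<Sum>e\<le>L + k. of_nat (e choose a) * (Var i - Var j) ^ (e - a) *
        (of_nat ((L + k - g c) choose e) * Var j ^ (L + k - g c - e)))"
      using B_row[of i a c] ac by simp
    also have "\<dots> = (\<Sum>e\<le>L + k. of_nat (e choose a) * (Var i - Var j) ^ (e - a) * w e c)"
      unfolding sum_distrib_left w_def by (rule sum.cong) (simp_all only: mult_ac)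
    finally show "B $$ (row_of \<nu> i (k - a), c) =
        (\<Sum>e\<le>L + k. of_nat (e choose a) * (Var i - Var j) ^ (e - a) * w e c)" .
  next
    show "(\<lambda>a. row_of \<nu> i (k - a)) ` {..<k} \<subseteq> {..<M}" "(\<lambda>a. row_of \<nu> j (k - a)) ` {..<k} \<subseteq> {..<M}"
      using row_lt by blast+
    show "B \<in> carrier_mat M M" "k \<le> Suc (L + k)"
      by (simp_all add: B_def)
  qed (simp_all add: inj)
  also have "det B = (\<Prod>r=0..<M. s r) * det ?A"
    unfolding B_def by (rule det_scale_rows) (simp add: col_minor_def)
  finally have dvd: "(Var i - Var j) ^ k\<^sup>2 dvd (\<Prod>r=0..<M. s r) * det ?A" .
  have prime: "prime_elem (Var i - Var j)"
    by (rule prime_elem_Var_diff) (use assms in auto)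
  have "\<not> Var i - Var j dvd (\<Prod>r=0..<M. s r)"
  proof
    assume "Var i - Var j dvd (\<Prod>r=0..<M. s r)"
    then obtain r where "Var i - Var j dvd s r"
      using prime_elem_dvd_prodD[OF prime] by blast
    then have "insertion (Var(i := Var j)) (s r) = 0"
      using assms by (simp add: Var_diff_dvd_iff)
    moreover obtain b m where "row_index \<nu> ! r = (b, m)"
      by fastforce
    ultimately show False
      \<comment> \<open>The substitution sends both variables to \<open>Var j\<close>, so a scale
        factor becomes 1 or a positive integer times a power of \<open>Var j\<close>.\<close>
      by (auto simp: s_def insertion_mult insertion_power split: if_splits)
  qed
  then show ?thesis
    using prime_elem_power_dvd_multD[OF prime _ dvd] by (simp add: k_def)
qed

end

subsection \<open>A nonzero minor\<close>

text \<open>The Newton basis polynomial \<open>X choose h\<close>.\<close>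

definition binomial_poly :: "nat \<Rightarrow> rat poly" where
  "binomial_poly h = smult (1 / fact h) (\<Prod>i=0..<h. [:- of_nat i, 1:])"

lemma poly_binomial_poly: "poly (binomial_poly h) (of_nat n) = of_nat (n choose h)"
  by (simp add: binomial_poly_def poly_prod binomial_gbinomial gbinomial_prod_rev)

lemma degree_binomial_poly_le: "degree (binomial_poly h) \<le> h"
proof -
  have "degree (\<Prod>i=0..<h. [:- of_nat i, 1 :: rat:]) \<le> (\<Sum>i=0..<h. degree [:- of_nat i, 1 :: rat:])"
    by (rule degree_prod_sum_le[unfolded o_def]) simp
  then show ?thesis
    by (simp add: binomial_poly_def)
qed

text \<open>The polynomial \<open>\<Sum>h\<in>B. w h * (X choose h)\<close> also vanishes at \<open>0, \<dots>, s - 1\<close>, so it has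
  more roots than its degree.\<close>

lemma binomial_combination_eq_0:
  fixes w :: "nat \<Rightarrow> int"
  assumes "s \<le> L" "B \<subseteq> {s..<s + m}"
    and "\<And>i. 1 \<le> i \<Longrightarrow> i \<le> m \<Longrightarrow> (\<Sum>h\<in>B. int ((L + i) choose h) * w h) = 0"
    and "h \<in> B"
  shows "w h = 0"
proof -
  define P where "P = (\<Sum>h\<in>B. smult (of_int (w h)) (binomial_poly h))"
  have finB: "finite B"
    using assms(2) finite_subset by blast
  have P: "poly P (of_nat n) = of_int (\<Sum>h\<in>B. int (n choose h) * w h)" for n
    by (simp add: P_def poly_sum poly_binomial_poly mult.commute)
  \<comment> \<open>Below \<open>s\<close> every \<open>n choose h\<close> with
    \<open>h \<in> B\<close> vanishes; the points above \<open>L\<close> are the hypothesis.\<close>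
  have zero: "poly P (of_nat n) = 0" if "n \<in> {..<s} \<union> {L + 1..L + m}" for n
  proof (cases "n < s")
    case True
    then have "(\<Sum>h\<in>B. int (n choose h) * w h) = 0"
      using assms(2) by (intro sum.neutral) (auto simp: binomial_eq_0)
    then show ?thesis
      by (simp only: P of_int_0)
  next
    case False
    then have "(\<Sum>h\<in>B. int (n choose h) * w h) = 0"
      using assms(3)[of "n - L"] that by auto
    then show ?thesis
      by (simp only: P of_int_0)
  qed
  have "P = 0"
  proof (rule ccontr)
    assume nz: "P \<noteq> 0"
    then have "m > 0"
      using assms(2) by (cases m) (auto simp: P_def)
    have "degree (smult (of_int (w h)) (binomial_poly h)) \<le> s + m - 1" if "h \<in> B" for h
      using degree_smult_le[of "of_int (w h)" "binomial_poly h"] degree_binomial_poly_le[of h]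
        subsetD[OF assms(2) that] by auto
    then have "degree P \<le> s + m - 1"
      unfolding P_def by (intro degree_sum_le finB) auto
    \<comment> \<open>\<open>s \<le> L\<close> keeps the two groups of roots disjoint.\<close>
    moreover have "s + m = card ((of_nat :: nat \<Rightarrow> rat) ` ({..<s} \<union> {L + 1..L + m}))"
      using assms(1) by (subst card_image, simp, subst card_Un_disjoint) auto
    moreover have "\<dots> \<le> card {x. poly P x = 0}"
      using zero poly_roots_finite[OF nz] by (intro card_mono) auto
    moreover have "\<dots> \<le> degree P"
      by (rule card_poly_roots_bound[OF nz])
    ultimately show False
      using \<open>m > 0\<close> by linarith
  qed
  then have all: "(\<Sum>h\<in>B. int (n choose h) * w h) = 0" for n
    using P[of n] by (metis of_int_eq_0_iff poly_0)
  \<comment> \<open>Evaluation at the points of \<open>B\<close> is a unitriangular system: at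
    \<open>h\<close>, larger indices have coefficient 0 and smaller ones have weight 0 by
    induction.\<close>
  from assms(4) show ?thesis
  proof (induction h rule: less_induct)
    case (less h)
    have "(\<Sum>x\<in>B. int (h choose x) * w x) = (\<Sum>x\<in>B. if x = h then w x else 0)"
    proof (rule sum.cong[OF refl])
      fix x assume "x \<in> B"
      then show "int (h choose x) * w x = (if x = h then w x else 0)"
        using less.IH[of x] by (cases x h rule: linorder_cases) auto
    qed
    then show ?case
      using all[of h] less.prems finB by simp
  qed
qed

lemma downward_closed_eq_lessThan:
  fixes S :: "nat set"
  assumes "finite S" "\<And>x y. x \<in> S \<Longrightarrow> y \<le> x \<Longrightarrow> y \<in> S"
  shows "S = {..<card S}"
proof -
  have "x < card S" if "x \<in> S" for x
    using card_mono[of S "{..x}"] assms that by fastforce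
  then show ?thesis
    by (intro card_subset_eq) auto
qed

text \<open>The positions with \<open>b r \<le> k\<close> form an initial segment. The sum condition
  forces its image under \<open>p\<close> to have the least possible sum, so \<open>p\<close> maps
  each segment onto itself.\<close>

lemma permutes_block_preserving:
  fixes b :: "nat \<Rightarrow> 'm::linorder"
  assumes p: "p permutes {..<M}" and "mono_on {..<M} b"
    and sums: "\<And>j. (\<Sum>r | r < M \<and> b r = j. p r) = \<Sum>{r. r < M \<and> b r = j}"
    and r: "r < M"
  shows "b (p r) = b r"
proof -
  define S where "S k = {r. r < M \<and> b r \<le> k}" for k
  have finS: "finite (S k)" for k
    by (simp add: S_def)
  have img: "p ` S k = S k" for k
  proof -
    have Sk: "S k = {..<card (S k)}"
    proof (rule downward_closed_eq_lessThan[OF finS])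
      fix x y assume "x \<in> S k" "y \<le> x"
      moreover from this have "b y \<le> b x"
        using assms(2) by (auto simp: S_def mono_on_def)
      ultimately show "y \<in> S k"
        by (auto simp: S_def)
    qed
    have inj: "inj_on p (S k)"
      using permutes_inj[OF p] inj_on_subset by blast
    have "(\<Sum>r\<in>S k. f r) = (\<Sum>j\<in>b ` S k. \<Sum>r | r < M \<and> b r = j. f r)" for f :: "nat \<Rightarrow> nat"
    proof -
      have "{x \<in> S k. b x = j} = {r. r < M \<and> b r = j}" if "j \<in> b ` S k" for j
        using that by (auto simp: S_def)
      then show ?thesis
        by (simp add: sum.image_gen[OF finS[of k], of f b])
    qed
    then have "(\<Sum>r\<in>S k. p r) = \<Sum>(S k)"
      using sums by simp
    then have "\<Sum>(p ` S k) = \<Sum>{..<card (p ` S k)}"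
      using Sk inj by (simp add: sum.reindex card_image)
    then have "p ` S k = {..<card (p ` S k)}"
      by (intro eq_lessThan_if_sum_le) (simp_all add: finS)
    then show ?thesis
      using Sk inj by (simp add: card_image)
  qed
  \<comment> \<open>The segment of \<open>b r\<close> gives \<open>b (p r) \<le> b r\<close>; the
    segment of \<open>b (p r)\<close> gives the converse.\<close>
  have "p r \<in> S (b r)"
    using img[of "b r"] r by (auto simp: S_def)
  moreover have "p r < M"
    using permutes_in_image[OF p] r by simp
  then have "p r \<in> p ` S (b (p r))"
    unfolding img by (simp add: S_def)
  then have "r \<in> S (b (p r))"
    using permutes_inj[OF p] by (auto dest: injD)
  ultimately show ?thesis
    by (auto simp: S_def)
qed

context
  fixes \<nu> l :: "'m::{finite,linorder} \<Rightarrow> nat" and M L :: nat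
    and blk :: "nat \<Rightarrow> 'm" and pos :: "nat \<Rightarrow> nat"
  defines "M \<equiv> (\<Sum>j\<in>UNIV. \<nu> j)" and "L \<equiv> (\<Sum>j\<in>UNIV. l j)"
    and "blk \<equiv> \<lambda>r. fst (row_index \<nu> ! r)" and "pos \<equiv> \<lambda>r. snd (row_index \<nu> ! r)"
  assumes M_le_L: "M \<le> L"
begin

lemma mono_on_blk: "mono_on {..<M} blk"
  using sorted_fst_row_index[of \<nu>]
  by (auto simp: mono_on_def blk_def M_def sorted_iff_nth_mono length_row_index)

text \<open>Its determinant is the coefficient in the minor of the columns \<open>0, \<dots>, M - 1\<close> of the monomial
  to which exactly the block-preserving permutations contribute.\<close>

definition block_binomials :: "int mat" where
  "block_binomials = mat M M (\<lambda>(r, c). if blk c = blk r then int ((L + pos r) choose c) else 0)"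

text \<open>The part of a kernel vector in block \<open>j\<close> is the weight vector of a
  combination of \<open>X choose h\<close> that vanishes at
  \<open>L + 1, \<dots>, L + \<nu> j\<close>. Its columns lie in an interval of length
  \<open>\<nu> j\<close>, so all weights are zero.\<close>

lemma det_block_binomials: "det block_binomials \<noteq> 0"
proof
  assume "det block_binomials = 0"
  moreover have carr: "block_binomials \<in> carrier_mat M M"
    by (simp add: block_binomials_def)
  ultimately obtain v where v: "v \<in> carrier_vec M" "v \<noteq> 0\<^sub>v M" "block_binomials *\<^sub>v v = 0\<^sub>v M"
    using det_0_iff_vec_prod_zero by blast
  have "v $ c = 0" if c: "c < M" for c
  proof -
    define j where "j = blk c"
    define B where "B = {r. r < M \<and> blk r = j}"
    \<comment> \<open>The columns of the earlier blocks; block \<open>j\<close> starts at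
      \<open>card S\<close>.\<close>
    define S where "S = {r. r < M \<and> blk r < j}"
    have "card B = \<nu> j"
      using bij_betw_same_card[OF bij_betw_row_of[of \<nu> j]] by (simp add: B_def M_def blk_def)
    moreover have "S = {..<card S}"
    proof (rule downward_closed_eq_lessThan)
      fix x y assume "x \<in> S" "y \<le> x"
      moreover from this have "blk y \<le> blk x"
        using mono_on_blk by (auto simp: S_def mono_on_def)
      ultimately show "y \<in> S"
        by (auto simp: S_def)
    qed (simp add: S_def)
    moreover have "S \<union> B = {..<card (S \<union> B)}"
    proof (rule downward_closed_eq_lessThan)
      fix x y assume "x \<in> S \<union> B" "y \<le> x"
      moreover from this have "blk y \<le> blk x"
        using mono_on_blk by (auto simp: S_def B_def mono_on_def)
      ultimately show "y \<in> S \<union> B"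
        by (auto simp: S_def B_def)
    qed (simp add: S_def B_def)
    moreover have "S \<inter> B = {}" "finite S" "finite B"
      by (auto simp: S_def B_def)
    ultimately have B: "B \<subseteq> {card S..<card S + \<nu> j}"
      by (metis (no_types, lifting) Int_iff UnI2 atLeastLessThan_iff card_Un_disjoint empty_iff
          lessThan_iff not_le_imp_less subsetI)
    have "card S \<le> M"
      using card_mono[of "{..<M}" S] by (auto simp: S_def)
    then have "card S \<le> L"
      using M_le_L by simp
    then show ?thesis
      using B
    proof (rule binomial_combination_eq_0[where w = "\<lambda>c. v $ c"])
      fix i assume i: "1 \<le> i" "i \<le> \<nu> j"
      define r where "r = row_of \<nu> j i"
      have r: "r < M" "blk r = j" "pos r = i"
        using row_of[of i \<nu> j] i by (auto simp: r_def M_def blk_def pos_def)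
      have "0 = (block_binomials *\<^sub>v v) $ r"
        using v r by simp
      also have "\<dots> = (\<Sum>c=0..<M. (if blk c = j then int ((L + i) choose c) else 0) * v $ c)"
        using r v(1) by (simp add: block_binomials_def scalar_prod_def cong: if_cong)
      also have "\<dots> = (\<Sum>c\<in>B. int ((L + i) choose c) * v $ c)"
        by (rule sum.mono_neutral_cong_right) (auto simp: B_def)
      finally show "(\<Sum>c\<in>B. int ((L + i) choose c) * v $ c) = 0" ..
    qed (use c in \<open>simp add: B_def j_def\<close>)
  qed
  then have "v = 0\<^sub>v M"
    using v(1) by auto
  with v(2) show False ..
qed

text \<open>The exponent of variable \<open>j\<close> is the sum of \<open>L - p r\<close> over
  block \<open>j\<close>, so equal monomials mean equal block sums of \<open>p\<close>. Conversely,
  a block-preserving \<open>p\<close> merely reindexes the sum.\<close>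

lemma block_monomial_eq_iff:
  assumes p: "p permutes {0..<M}"
  shows "(\<Sum>r=0..<M. Poly_Mapping.single (blk r) (L - p r)) =
      (\<Sum>r=0..<M. Poly_Mapping.single (blk r) (L - r)) \<longleftrightarrow> (\<forall>r<M. blk (p r) = blk r)"
    (is "?m p = ?m (\<lambda>r. r) \<longleftrightarrow> _")
proof -
  have p': "p permutes {..<M}"
    using p by (simp add: lessThan_atLeast0)
  have pM: "p r < M" if "r < M" for r
    using permutes_in_image[OF p'] that by simp
  have lookup: "Poly_Mapping.lookup (?m q) j = (\<Sum>r | r < M \<and> blk r = j. L - q r)" for q j
    unfolding lookup_sum by (rule sum.mono_neutral_cong_right)
      (auto simp: lookup_single when_def)
  show ?thesis
  proof
    assume eq: "?m p = ?m (\<lambda>r. r)"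
    have "(\<Sum>r | r < M \<and> blk r = j. p r) = \<Sum>{r. r < M \<and> blk r = j}" for j
    proof -
      let ?B = "{r. r < M \<and> blk r = j}"
      have "(\<Sum>r\<in>?B. L - q r) + (\<Sum>r\<in>?B. q r) = card ?B * L"
        if "\<And>r. r < M \<Longrightarrow> q r < M" for q
      proof -
        have "(\<Sum>r\<in>?B. L - q r) + (\<Sum>r\<in>?B. q r) = (\<Sum>r\<in>?B. L)"
          unfolding sum.distrib[symmetric]
        proof (rule sum.cong[OF refl])
          fix r assume "r \<in> ?B"
          then show "L - q r + q r = L"
            using that[of r] M_le_L by simp
        qed
        then show ?thesis
          by simp
      qed
      from this[of p] this[of "\<lambda>r. r"] show ?thesis
        using lookup[of p j] lookup[of "\<lambda>r. r" j] pM eq by simp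
    qed
    then show "\<forall>r<M. blk (p r) = blk r"
      using permutes_block_preserving[OF p' mono_on_blk] by blast
  next
    assume blk: "\<forall>r<M. blk (p r) = blk r"
    have "?m p = (\<Sum>r=0..<M. Poly_Mapping.single (blk (p r)) (L - p r))"
      by (rule sum.cong) (use blk in auto)
    also have "\<dots> = ?m (\<lambda>r. r)"
      using sum.permute[OF p, of "\<lambda>r. Poly_Mapping.single (blk r) (L - r)"] by (simp add: comp_def)
    finally show "?m p = ?m (\<lambda>r. r)" .
  qed
qed

text \<open>Each Leibniz term is one monomial. At the monomial of the identity, terms that break a
  block contribute 0, just as they do to \<open>det block_binomials\<close>.\<close>

lemma det_leading_minor_V_mat: "det (col_minor (V_mat \<nu> l) M id) \<noteq> 0"
proof -
  let ?A = "col_minor (V_mat \<nu> l) M id"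
  define \<mu> where "\<mu> p = (\<Sum>r=0..<M. Poly_Mapping.single (blk r) (L - p r))" for p :: "nat \<Rightarrow> nat"
  have coeff: "Poly_Mapping.lookup (signof p * (\<Prod>r=0..<M. ?A $$ (r, p r))) (\<mu> id) =
      signof p * (\<Prod>r=0..<M. block_binomials $$ (r, p r))" if p: "p permutes {0..<M}" for p
  proof -
    have pM: "p r < M" if "r < M" for r
      using permutes_in_image[OF p] that by simp
    have "?A $$ (r, p r) = Poly_Mapping.single (Poly_Mapping.single (blk r) (L - p r))
        (int ((L + pos r) choose p r))" if "r < M" for r
      using V_mat_index[of r \<nu> "p r" l "blk r" "pos r"] that pM[OF that] M_le_L
      by (simp add: col_minor_def M_def L_def blk_def pos_def Var_power mult_single
        flip: single_of_nat)
    then have "(\<Prod>r=0..<M. ?A $$ (r, p r)) = (\<Prod>r=0..<M.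
        of_int (int ((L + pos r) choose p r)) * Poly_Mapping.single (Poly_Mapping.single (blk r) (L - p r)) 1)"
      by (intro prod.cong) (simp_all add: mult_single flip: single_of_nat)
    also have "\<dots> = of_int (\<Prod>r=0..<M. int ((L + pos r) choose p r)) * Poly_Mapping.single (\<mu> p) 1"
      by (simp add: prod.distrib prod_single_1 \<mu>_def)
    finally have "signof p * (\<Prod>r=0..<M. ?A $$ (r, p r)) =
        of_int (signof p * (\<Prod>r=0..<M. int ((L + pos r) choose p r))) * Poly_Mapping.single (\<mu> p) 1"
      by (simp add: mult.assoc)
    also have "\<dots> = Poly_Mapping.single (\<mu> p) (signof p * (\<Prod>r=0..<M. int ((L + pos r) choose p r)))"
      by (simp only: single_of_int[symmetric] mult_single) simp
    finally have *: "Poly_Mapping.lookup (signof p * (\<Prod>r=0..<M. ?A $$ (r, p r))) (\<mu> id) =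
        (if \<mu> p = \<mu> id then signof p * (\<Prod>r=0..<M. int ((L + pos r) choose p r)) else 0)"
      by (simp add: lookup_single when_def)
    show ?thesis
    proof (cases "\<forall>r<M. blk (p r) = blk r")
      case True
      then have "(\<Prod>r=0..<M. block_binomials $$ (r, p r)) = (\<Prod>r=0..<M. int ((L + pos r) choose p r))"
        using pM by (intro prod.cong) (auto simp: block_binomials_def)
      then show ?thesis
        using * True block_monomial_eq_iff[OF p] by (simp add: \<mu>_def)
    next
      case False
      then obtain r where "r < M" "blk (p r) \<noteq> blk r"
        by blast
      then have "(\<Prod>r=0..<M. block_binomials $$ (r, p r)) = 0"
        using pM by (intro prod_zero) (auto simp: block_binomials_def)
      then show ?thesis
        using * False block_monomial_eq_iff[OF p] by (simp add: \<mu>_def)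
    qed
  qed
  have carr: "?A \<in> carrier_mat M M" "block_binomials \<in> carrier_mat M M"
    by (simp_all add: col_minor_def block_binomials_def)
  have "Poly_Mapping.lookup (det ?A) (\<mu> id) = det block_binomials"
    unfolding det_def'[OF carr(1)] det_def'[OF carr(2)] lookup_sum
    by (rule sum.cong) (simp_all add: coeff)
  then show ?thesis
    using det_block_binomials by auto
qed

end

subsection \<open>The gcd of the minors\<close>

lemma min_power2: "min (a\<^sup>2) (b\<^sup>2) = (min a b :: nat)\<^sup>2"
  by (simp add: min_def power2_nat_le_eq_le)

theorem theorem6p2:
  fixes \<nu> l :: "'m::{finite,linorder} \<Rightarrow> nat"
    and D :: "'m int_mpoly"
  assumes "\<And>j. 1 \<le> \<nu> j \<and> \<nu> j \<le> l j"
    and "is_primitive_gcd_of D (minors (\<Sum>j\<in>UNIV. \<nu> j) (V_mat \<nu> l))"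
  shows "(\<Prod>j\<in>UNIV. Var j ^ (\<nu> j choose 2)) *
         (\<Prod>(i, j)\<in>{(i, j). i < j}. (Var i - Var j) ^ min ((\<nu> i)\<^sup>2) ((\<nu> j)\<^sup>2)) dvd D"
proof -
  define M where "M = (\<Sum>j\<in>UNIV. \<nu> j)"
  define L where "L = (\<Sum>j\<in>UNIV. l j)"
  have "M \<le> L"
    unfolding M_def L_def using assms(1) by (intro sum_mono) auto
  have dims: "dim_row (V_mat \<nu> l) = M" "dim_col (V_mat \<nu> l) = L + 1"
    by (simp_all add: V_mat_def Let_def M_def L_def)
  obtain G where G: "is_gcd_of G (minors M (V_mat \<nu> l))" "G = of_int (content G) * D"
    using assms(2) by (auto simp: is_primitive_gcd_of_def M_def)
  have "det (col_minor (V_mat \<nu> l) M id) \<noteq> 0"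
    using det_leading_minor_V_mat[of \<nu> l] \<open>M \<le> L\<close> by (simp add: M_def L_def)
  moreover have "det (col_minor (V_mat \<nu> l) M id) \<in> minors M (V_mat \<nu> l)"
    using col_minor_in_minors[of "V_mat \<nu> l"] \<open>M \<le> L\<close> by (simp add: dims)
  ultimately have "G \<noteq> 0"
    using G(1) by (auto simp: is_gcd_of_def)
  \<comment> \<open>\<open>G \<noteq> 0\<close> is what makes the content a nonzero integer, which
    can then be cancelled against the primes.\<close>
  then have content: "content G \<noteq> 0"
    using G(2) by auto
  have dvd_G: "d dvd G"
    if all: "\<And>g. inj_on g {..<M} \<Longrightarrow> (\<And>c. c < M \<Longrightarrow> g c \<le> L) \<Longrightarrow> d dvd det (col_minor (V_mat \<nu> l) M g)"
    for d
  proof -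
    have "d dvd x" if x: "x \<in> minors M (V_mat \<nu> l)" for x
    proof (rule minors_cases[of x "V_mat \<nu> l"])
      show "x \<in> minors (dim_row (V_mat \<nu> l)) (V_mat \<nu> l)"
        using x by (simp add: dims)
    next
      fix g assume "inj_on g {..<dim_row (V_mat \<nu> l)}"
        "\<And>c. c < dim_row (V_mat \<nu> l) \<Longrightarrow> g c < dim_col (V_mat \<nu> l)"
        "x = det (col_minor (V_mat \<nu> l) (dim_row (V_mat \<nu> l)) g)"
      then show "d dvd x"
        using all[of g] by (simp add: dims less_Suc_eq_le)
    qed
    then show ?thesis
      using G(1) by (auto simp: is_gcd_of_def)
  qed
  \<comment> \<open>The sum type joins the variables and their differences into a single family of
    primes.\<close>
  define q :: "'m + 'm \<times> 'm \<Rightarrow> 'm int_mpoly" where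
    "q = case_sum Var (\<lambda>(i, j). Var i - Var j)"
  define e where "e = case_sum (\<lambda>j. \<nu> j choose 2) (\<lambda>(i, j). min ((\<nu> i)\<^sup>2) ((\<nu> j)\<^sup>2))"
  let ?S = "(UNIV :: 'm set) <+> {(i :: 'm, j). i < j}"
  have "(\<Prod>s\<in>?S. q s ^ e s) dvd D"
  proof (rule prod_prime_powers_dvd)
    show "finite ?S"
      by simp
  next
    fix s assume s: "s \<in> ?S"
    show prime: "prime_elem (q s)"
      using s by (auto simp: q_def prime_elem_Var intro!: prime_elem_Var_diff)
    have "q s ^ e s dvd G"
    proof (rule dvd_G)
      fix g assume "inj_on g {..<M}" "\<And>c. c < M \<Longrightarrow> g c \<le> L"
      then show "q s ^ e s dvd det (col_minor (V_mat \<nu> l) M g)"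
        using s Var_power_dvd_minor[of g \<nu> l] Var_diff_power_dvd_minor[of g \<nu> l]
        by (auto simp: q_def e_def min_power2 M_def L_def)
    qed
    then have "q s ^ e s dvd of_int (content G) * D"
      using G(2) by simp
    \<comment> \<open>Substitution leaves a nonzero integer unchanged, so these primes do not divide
      the content.\<close>
    moreover have "\<not> q s dvd of_int (content G)"
      using s content by (auto simp: q_def Var_dvd_iff Var_diff_dvd_iff)
    ultimately show "q s ^ e s dvd D"
      using prime prime_elem_power_dvd_multD by blast
  next
    fix s t assume "s \<in> ?S" "t \<in> ?S" "s \<noteq> t"
    \<comment> \<open>Substituting the root of \<open>q s\<close> into \<open>q t\<close> leaves a
      nonzero polynomial; \<open>i < j\<close> excludes the associated pair of differences with
      opposite sign.\<close>
    then show "\<not> q s dvd q t"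
      by (auto simp: q_def Var_dvd_iff Var_diff_dvd_iff insertion_diff split: if_splits)
  qed
  moreover have "(\<Prod>s\<in>?S. q s ^ e s) = (\<Prod>j\<in>UNIV. Var j ^ (\<nu> j choose 2)) *
      (\<Prod>(i, j)\<in>{(i, j). i < j}. (Var i - Var j) ^ min ((\<nu> i)\<^sup>2) ((\<nu> j)\<^sup>2))"
    by (simp add: prod.Plus q_def e_def case_prod_unfold)
  ultimately show ?thesis
    by simp
qed

end
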